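(* Let $\Psi,J$ be as described in the context, let $0<\epsilon<1$, and let $\rho(1,\theta,t)=\Psi(\theta,t)$ and $\overline K(1,\theta,t)=J(\theta,t)(-\sin\theta,\cos\theta,0)$ for $\theta\in[-\pi,\pi)$ be the corresponding density and current on the unit circle. Then there exists a smooth pair $(\rho_1,\overline J)$, with $\rho_1$ real-valued and $\overline J$ valued in $\mathbb R^3$, supported (in the space variables) on $\mathrm{Ann}(1,\epsilon)\times(-\epsilon,\epsilon)$, such that $(\rho_1,\overline J)$ satisfies the continuity equation $$\frac{\partial\rho_1}{\partial t}+\nabla\cdot\overline J=0$$ in $\mathbb R^3\times\mathbb R_{>0}$, and $\rho_1|_{S^1\times\{0\}}=\rho$, $\overline J|_{S^1\times\{0\}}=\overline K$.
   Context: The interval $[-\pi,\pi]$ is regarded as the circle (endpoints identified). $\Psi$ is the real solution of $\frac{\partial^2\Psi}{\partial t^2}-\frac{\partial^2\Psi}{\partial x^2}=0$ with real initial data $\Psi(x,0)=\Psi_0(x)$, $\frac{\partial\Psi}{\partial t}(x,0)=\Psi_1(x)$, $\Psi_0,\Psi_1$ smooth on the circle, and $J(x,t)=\int_{-\pi}^x-\frac{\partial\Psi}{\partial t}(y,t)\,dy$ is the associated current, so that $\frac{\partial\Psi}{\partial t}+\frac{\partial J}{\partial x}=0$. In cylindrical coordinates $(r,\theta,z)$ on $\mathbb R^3$, $S^1=\{r=1\}$ is the unit circle in the plane and $\mathrm{Ann}(1,\epsilon)=\{(r,\theta):1-\epsilon<r<1+\epsilon\}$ is the planar annulus; $S^1\times\{0\}$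 is the unit circle in the plane $z=0$.
   Formalization: The formal theorem additionally assumes J(π,t)=J(−π,t) for t≥0, i.e. that J is a function on the circle; without it the claim fails (e.g. Ψ=t gives J=−(θ+π), which jumps at θ=π), and the condition is necessary. *)

theory Defs
  imports "HOL-Analysis.Analysis"
begin

(* Meaningful for open U only: frechet_derivative is then the unique total derivative. *)
primrec Ck_open :: "nat \<Rightarrow> 'a::real_normed_vector set \<Rightarrow> ('a \<Rightarrow> 'b::real_normed_vector) \<Rightarrow> bool" where
  "Ck_open 0 U f \<longleftrightarrow> continuous_on U f"
| "Ck_open (Suc k) U f \<longleftrightarrow>
     (\<forall>x\<in>U. f differentiable (at x)) \<and>
     (\<forall>v. Ck_open k U (\<lambda>x. frechet_derivative f (at x) v))"

(* On an arbitrary set, regularity means that f extends locally to a function of that class on an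
   open set; it is used here for half-spaces t >= 0, i.e. regularity up to the boundary. *)
definition Ck_on :: "nat \<Rightarrow> 'a::real_normed_vector set \<Rightarrow> ('a \<Rightarrow> 'b::real_normed_vector) \<Rightarrow> bool" where
  "Ck_on k S f \<longleftrightarrow>
     (\<forall>x\<in>S. \<exists>U g. open U \<and> x \<in> U \<and> Ck_open k U g \<and> (\<forall>y\<in>S \<inter> U. g y = f y))"

definition smooth_on :: "'a::real_normed_vector set \<Rightarrow> ('a \<Rightarrow> 'b::real_normed_vector) \<Rightarrow> bool" where
  "smooth_on S f \<longleftrightarrow>
     (\<forall>x\<in>S. \<exists>U g. open U \<and> x \<in> U \<and> (\<forall>k. Ck_open k U g) \<and> (\<forall>y\<in>S \<inter> U. g y = f y))"

(* Functions on the circle [-pi,pi] with endpoints identified are 2 pi-periodic functions on the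
   real line. *)
definition on_circle :: "(real \<Rightarrow> 'b) \<Rightarrow> bool" where
  "on_circle f \<longleftrightarrow> (\<forall>x. f (x + 2 * pi) = f x)"

(* The time derivative for t >= 0; it is one-sided at t = 0. *)
definition time_deriv :: "(real \<Rightarrow> real \<Rightarrow> real) \<Rightarrow> real \<Rightarrow> real \<Rightarrow> real" where
  "time_deriv \<Psi> x t = vector_derivative (\<lambda>s. \<Psi> x s) (at t within {0..})"

definition circle_wave_solution ::
    "(real \<Rightarrow> real) \<Rightarrow> (real \<Rightarrow> real) \<Rightarrow> (real \<Rightarrow> real \<Rightarrow> real) \<Rightarrow> bool" where
  "circle_wave_solution \<Psi>\<^sub>0 \<Psi>\<^sub>1 \<Psi> \<longleftrightarrow>
     (\<forall>t\<ge>0. on_circle (\<lambda>x. \<Psi> x t)) \<and>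
     Ck_on 2 (UNIV \<times> {0..}) (\<lambda>(x, t). \<Psi> x t) \<and>
     (\<forall>x. \<forall>t>0. (deriv ^^ 2) (\<lambda>s. \<Psi> x s) t - (deriv ^^ 2) (\<lambda>y. \<Psi> y t) x = 0) \<and>
     (\<forall>x. \<Psi> x 0 = \<Psi>\<^sub>0 x) \<and>
     (\<forall>x. time_deriv \<Psi> x 0 = \<Psi>\<^sub>1 x)"

(* Used for x in [-pi,pi] only. Identifying the endpoints, this is a function on the circle iff its
   values at -pi (namely 0) and pi agree, i.e. iff the integral of the time derivative over the
   circle vanishes; this is not automatic (take Psi(x,t) = t). *)
definition circle_current :: "(real \<Rightarrow> real \<Rightarrow> real) \<Rightarrow> real \<Rightarrow> real \<Rightarrow> real" where
  "circle_current \<Psi> x t = integral {-pi..x} (\<lambda>y. - time_deriv \<Psi> y t)"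

definition annular_tube :: "real \<Rightarrow> (real ^ 3) set" where
  "annular_tube \<epsilon> =
     {p. 1 - \<epsilon> < sqrt ((p $ 1)\<^sup>2 + (p $ 2)\<^sup>2) \<and> sqrt ((p $ 1)\<^sup>2 + (p $ 2)\<^sup>2) < 1 + \<epsilon> \<and>
         - \<epsilon> < p $ 3 \<and> p $ 3 < \<epsilon>}"

definition space_support :: "((real ^ 3) \<times> real \<Rightarrow> 'b::zero) \<Rightarrow> real \<Rightarrow> (real ^ 3) set" where
  "space_support f t = closure {p. f (p, t) \<noteq> 0}"

definition divergence :: "(real ^ 3 \<Rightarrow> real ^ 3) \<Rightarrow> real ^ 3 \<Rightarrow> real" where
  "divergence F p = (\<Sum>i\<in>UNIV. frechet_derivative F (at p) (axis i 1) $ i)"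

end

(* The solution is Psi(x,t) = F(x+t) + G(x-t) with F, G smooth; the current closes up on the circle
   exactly when F and G are periodic, and then J(x,t) = -F(x+t) + G(x-t) + C(t). Let h be a smooth
   cut-off depending only on r and z, equal to 1 on the circle and supported in the tube. Put
   rho = h Psi(theta,t) and Jbar = h J(theta,t) (-y,x,0), i.e. J is scaled by r in the angular
   direction. Since (-y,x,0) is divergence free and generates the rotations, which fix h, the
   divergence of Jbar is h dJ/dtheta, and the continuity equation reduces to the one on the circle. *)

theory Submission
  imports Defs
begin

subsection \<open>Closure properties of the smoothness classes\<close>

text \<open>The given \<open>\<Psi>\<close> is only of class C^2 up to t = 0, so smoothness has to
  be imported from the data: d'Alembert's formula is established for this very solution, with
  \<open>F\<close> and \<open>G\<close> built from \<open>\<Psi>\<^sub>0\<close> and an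
  antiderivative \<open>P\<close> of \<open>\<Psi>\<^sub>1\<close>. The formula makes sense for all
  real t, hence the pair is smooth on the whole of R^3 x R and the boundary t = 0 needs no separate
  extension. Periodicity of \<open>F\<close> and \<open>G\<close> reduces to
  \<open>\<Psi>\<^sub>1\<close> having mean zero, which is the closing of the current at the single
  time t = 0. It is what makes the lift smooth: the principal argument jumps across a half-plane,
  and functions of the angle pass this jump by being periodic. The axis, where there is no angle, is
  removed by the cut-off.\<close>

lemma Ck_open_cong:
  assumes "open U" "\<And>x. x \<in> U \<Longrightarrow> f x = g x" "Ck_open k U f"
  shows "Ck_open k U g"
  using assms(2,3)
proof (induction k arbitrary: f g)
  case 0
  then show ?case using continuous_on_cong[of U U f g] by auto
next
  case (Suc k)
  have *: "(g has_derivative frechet_derivative f (at x)) (at x)" if "x \<in> U" for x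
  proof (rule has_derivative_transform_within_open[OF _ assms(1) that])
    show "(f has_derivative frechet_derivative f (at x)) (at x)"
      using Suc.prems(2) that frechet_derivative_works by auto
  qed (use Suc.prems(1) in auto)
  have eq: "frechet_derivative g (at x) = frechet_derivative f (at x)" if "x \<in> U" for x
    using frechet_derivative_at[OF *[OF that]] by simp
  have "Ck_open k U (\<lambda>x. frechet_derivative g (at x) v)" for v
    by (rule Suc.IH[of "\<lambda>x. frechet_derivative f (at x) v"]) (use eq Suc.prems(2) in simp_all)
  then show ?case using * by (auto simp: differentiable_def)
qed

lemma Ck_open_subset: "Ck_open k U f \<Longrightarrow> V \<subseteq> U \<Longrightarrow> Ck_open k V f"
proof (induction k arbitrary: f)
  case 0
  then show ?case by (auto intro: continuous_on_subset)
next
  case (Suc k)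
  then show ?case unfolding Ck_open.simps(2) by blast
qed

lemma Ck_open_local:
  assumes "\<And>x. x \<in> S \<Longrightarrow> \<exists>U. open U \<and> x \<in> U \<and> Ck_open k U f"
  shows "Ck_open k S f"
  using assms
proof (induction k arbitrary: f)
  case 0
  show ?case unfolding Ck_open.simps
    by (rule continuous_at_imp_continuous_on)
      (metis "0" Ck_open.simps(1) continuous_on_eq_continuous_at)
next
  case (Suc k)
  have "f differentiable (at x)" if "x \<in> S" for x
    using Suc.prems[OF that] by auto
  moreover have "Ck_open k S (\<lambda>x. frechet_derivative f (at x) v)" for v
    by (rule Suc.IH) (use Suc.prems in \<open>unfold Ck_open.simps(2), blast\<close>)
  ultimately show ?case by auto
qed

lemma Ck_open_has_derivative:
  assumes "Ck_open (Suc k) U f" "x \<in> U"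
  shows "(f has_derivative frechet_derivative f (at x)) (at x)"
  using assms frechet_derivative_works by auto

text \<open>Uniqueness of the derivative on an open set allows any formula for it to replace
  \<open>frechet_derivative\<close>; the closure properties below thus start from the usual
  differentiation rules.\<close>

lemma Ck_open_SucI:
  assumes "open U" "\<And>x. x \<in> U \<Longrightarrow> (f has_derivative f' x) (at x)"
    and "\<And>v. Ck_open k U (\<lambda>x. f' x v)"
  shows "Ck_open (Suc k) U f"
proof -
  have "Ck_open k U (\<lambda>x. frechet_derivative f (at x) v)" for v
    by (rule Ck_open_cong[OF assms(1) _ assms(3)[of v]])
      (simp add: frechet_derivative_at[OF assms(2), symmetric])
  then show ?thesis using assms(2) by (auto simp: differentiable_def)
qed

lemma Ck_open_Suc_imp: "Ck_open (Suc k) U f \<Longrightarrow> Ck_open k U f"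
proof (induction k arbitrary: f)
  case 0
  then have "continuous_on U f"
    by (intro continuous_at_imp_continuous_on) (auto intro: differentiable_imp_continuous_within)
  then show ?case by simp
next
  case (Suc k)
  show ?case unfolding Ck_open.simps(2)[of k]
    using Suc.prems Suc.IH unfolding Ck_open.simps(2)[of "Suc k"] by blast
qed

lemma Ck_open_const: "Ck_open k U (\<lambda>x. c)"
proof (induction k arbitrary: c)
  case (Suc k)
  then show ?case by (auto simp: frechet_derivative_const)
qed simp

lemma Ck_open_linear:
  assumes "bounded_linear f" "open U"
  shows "Ck_open k U f"
proof (cases k)
  case 0
  then show ?thesis using assms by (auto intro: linear_continuous_on)
next
  case (Suc m)
  show ?thesis unfolding Suc
    by (rule Ck_open_SucI[OF assms(2) bounded_linear_imp_has_derivative[OF assms(1)] Ck_open_const])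
qed

lemma Ck_open_add:
  assumes "open U" "Ck_open k U f" "Ck_open k U g"
  shows "Ck_open k U (\<lambda>x. f x + g x)"
  using assms(2,3)
proof (induction k arbitrary: f g)
  case 0
  then show ?case by (auto intro: continuous_on_add)
next
  case (Suc k)
  show ?case
    by (rule Ck_open_SucI[OF assms(1) has_derivative_add])
      (use Suc in \<open>auto intro: Ck_open_has_derivative\<close>)
qed

text \<open>A general bilinear map covers products of real functions and multiples of vector fields
  at once. The product rule leaves one factor undifferentiated, so that factor is first lowered from
  class k + 1 to class k.\<close>

lemma Ck_open_bilinear:
  assumes "bounded_bilinear bop" "open U" "Ck_open k U f" "Ck_open k U g"
  shows "Ck_open k U (\<lambda>x. bop (f x) (g x))"
  using assms(3,4)
proof (induction k arbitrary: f g)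
  case 0
  then show ?case using bounded_bilinear.continuous_on[OF assms(1)] by auto
next
  case (Suc k)
  show ?case
  proof (rule Ck_open_SucI[OF assms(2)])
    fix x assume x: "x \<in> U"
    show "((\<lambda>x. bop (f x) (g x)) has_derivative
        (\<lambda>v. bop (f x) (frechet_derivative g (at x) v) + bop (frechet_derivative f (at x) v) (g x)))
        (at x)"
      by (intro bounded_bilinear.FDERIV[OF assms(1)] Ck_open_has_derivative[OF _ x])
        (use Suc.prems in auto)
  next
    fix v
    show "Ck_open k U (\<lambda>x. bop (f x) (frechet_derivative g (at x) v)
        + bop (frechet_derivative f (at x) v) (g x))"
      using Suc.prems
      by (intro Ck_open_add assms(2) Suc.IH Ck_open_Suc_imp[OF Suc.prems(1)]
          Ck_open_Suc_imp[OF Suc.prems(2)]) simp_all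
  qed
qed

lemmas Ck_open_mult = Ck_open_bilinear[OF bounded_bilinear_mult]
lemmas Ck_open_scaleR = Ck_open_bilinear[OF bounded_bilinear_scaleR]

lemma Ck_open_uminus:
  fixes f :: "'a::real_normed_vector \<Rightarrow> real"
  assumes "open U" "Ck_open k U f"
  shows "Ck_open k U (\<lambda>x. - f x)"
  using Ck_open_mult[OF assms(1) Ck_open_const[of k U "-1"] assms(2)] by simp

lemma Ck_open_diff:
  fixes f :: "'a::real_normed_vector \<Rightarrow> real"
  assumes "open U" "Ck_open k U f" "Ck_open k U g"
  shows "Ck_open k U (\<lambda>x. f x - g x)"
  using Ck_open_add[OF assms(1,2) Ck_open_uminus[OF assms(1,3)]] by simp

text \<open>With an outer function of one real variable the chain rule yields a product of two real
  functions, so the induction closes with \<open>Ck_open_mult\<close>.\<close>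

lemma Ck_open_real_compose:
  fixes u :: "'a::real_normed_vector \<Rightarrow> real" and f :: "real \<Rightarrow> real"
  assumes "open U" "Ck_open k UNIV f" "Ck_open k U u"
  shows "Ck_open k U (\<lambda>x. f (u x))"
  using assms(2,3)
proof (induction k arbitrary: f u)
  case 0
  then show ?case using continuous_on_compose2[of UNIV f U u] by auto
next
  case (Suc k)
  show ?case
  proof (rule Ck_open_SucI[OF assms(1)])
    fix x assume x: "x \<in> U"
    have f: "(f has_derivative frechet_derivative f (at (u x))) (at (u x))"
      by (rule Ck_open_has_derivative[OF Suc.prems(1)]) simp
    have "((\<lambda>x. f (u x)) has_derivative
        (\<lambda>v. frechet_derivative f (at (u x)) (frechet_derivative u (at x) v))) (at x)"
      by (rule has_derivative_compose[OF Ck_open_has_derivative[OF Suc.prems(2) x] f])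
    moreover have "(\<lambda>v. frechet_derivative f (at (u x)) (frechet_derivative u (at x) v)) =
        (\<lambda>v. frechet_derivative u (at x) v * frechet_derivative f (at (u x)) 1)"
    proof
      show "frechet_derivative f (at (u x)) (frechet_derivative u (at x) v) =
          frechet_derivative u (at x) v * frechet_derivative f (at (u x)) 1" for v
        using linear_scale[OF has_derivative_linear[OF f], of "frechet_derivative u (at x) v" 1]
        by simp
    qed
    ultimately show "((\<lambda>x. f (u x)) has_derivative
        (\<lambda>v. frechet_derivative u (at x) v * frechet_derivative f (at (u x)) 1)) (at x)"
      by (simp only:)
  next
    fix v
    have "Ck_open k UNIV (\<lambda>y. frechet_derivative f (at y) 1)"
      using Suc.prems(1) unfolding Ck_open.simps(2) by blast
    from Suc.IH[OF this Ck_open_Suc_imp[OF Suc.prems(2)]]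
    show "Ck_open k U (\<lambda>x. frechet_derivative u (at x) v * frechet_derivative f (at (u x)) 1)"
      by (intro Ck_open_mult assms(1)) (use Suc.prems in auto)
  qed
qed

text \<open>The derivative of 1/u is built from 1/u itself and the derivative of u; the induction
  hypothesis supplies 1/u one class lower.\<close>

lemma Ck_open_inverse:
  fixes u :: "'a::real_normed_vector \<Rightarrow> real"
  assumes "open U" "\<And>x. x \<in> U \<Longrightarrow> u x \<noteq> 0" "Ck_open k U u"
  shows "Ck_open k U (\<lambda>x. inverse (u x))"
  using assms(3)
proof (induction k)
  case 0
  then show ?case using assms(2) by (auto intro: continuous_on_inverse)
next
  case (Suc k)
  show ?case
  proof (rule Ck_open_SucI[OF assms(1)])
    fix x assume x: "x \<in> U"
    show "((\<lambda>x. inverse (u x)) has_derivative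
        (\<lambda>v. - (inverse (u x) * frechet_derivative u (at x) v * inverse (u x)))) (at x)"
      by (rule Deriv.has_derivative_inverse[OF assms(2)[OF x] Ck_open_has_derivative[OF Suc.prems x]])
  next
    fix v
    show "Ck_open k U (\<lambda>x. - (inverse (u x) * frechet_derivative u (at x) v * inverse (u x)))"
      by (intro Ck_open_uminus Ck_open_mult assms(1) Suc.IH Ck_open_Suc_imp[OF Suc.prems])
        (use Suc.prems in auto)
  qed
qed

lemma Ck_open_arctan:
  fixes u :: "'a::real_normed_vector \<Rightarrow> real"
  assumes "open U" "Ck_open k U u"
  shows "Ck_open k U (\<lambda>x. arctan (u x))"
proof (cases k)
  case 0
  then show ?thesis using assms(2) by (auto intro!: continuous_intros)
next
  case (Suc m)
  have u: "Ck_open (Suc m) U u" using assms Suc by simp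
  have "u x * u x + 1 \<noteq> 0" for x
    by (smt (verit) zero_le_square)
  show ?thesis unfolding Suc
  proof (rule Ck_open_SucI[OF assms(1)])
    fix x assume x: "x \<in> U"
    show "((\<lambda>x. arctan (u x)) has_derivative
        (\<lambda>v. frechet_derivative u (at x) v * inverse (1 + u x * u x))) (at x)"
      using has_derivative_compose[OF Ck_open_has_derivative[OF u x], of arctan
          "\<lambda>w. w * inverse (1 + u x * u x)"] DERIV_arctan[of "u x"]
      by (simp add: has_field_derivative_def power2_eq_square mult.commute[of _ "inverse _"])
  next
    fix v
    show "Ck_open m U (\<lambda>x. frechet_derivative u (at x) v * inverse (1 + u x * u x))"
      by (intro Ck_open_mult assms(1) Ck_open_inverse Ck_open_add Ck_open_const
          Ck_open_Suc_imp[OF u])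
        (use u in \<open>auto simp: add_nonneg_eq_0_iff\<close>)
  qed
qed

subsection \<open>D'Alembert's formula\<close>

lemma has_real_derivative_along_line:
  fixes f :: "'a::real_normed_vector \<Rightarrow> real"
  assumes "(f has_derivative f') (at (a + s *\<^sub>R v))"
  shows "((\<lambda>s. f (a + s *\<^sub>R v)) has_real_derivative f' v) (at s)"
proof -
  have "((\<lambda>s. a + s *\<^sub>R v) has_derivative (\<lambda>r. r *\<^sub>R v)) (at s)"
    by (auto intro!: derivative_eq_intros)
  from has_derivative_compose[OF this assms]
  have "((\<lambda>s. f (a + s *\<^sub>R v)) has_derivative (\<lambda>r. f' (r *\<^sub>R v))) (at s)" .
  moreover have "(\<lambda>r. f' (r *\<^sub>R v)) = (\<lambda>r. f' v * r)"
    by (simp add: linear_scale[OF has_derivative_linear[OF assms]] mult.commute)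
  ultimately show ?thesis
    by (simp add: has_field_derivative_def)
qed

text \<open>The mean value theorem is applied twice: in direction v to the increment of f by h w,
  then in direction w to the derivative of f along v. The second difference itself is symmetric in v
  and w, while the right-hand side records an order of differentiation.\<close>

lemma second_difference_mean_value:
  fixes f :: "'a::real_normed_vector \<Rightarrow> real"
  assumes f: "Ck_open (Suc (Suc 0)) U f" and "0 < h"
    and U: "\<And>s t. 0 \<le> s \<Longrightarrow> s \<le> h \<Longrightarrow> 0 \<le> t \<Longrightarrow> t \<le> h \<Longrightarrow> x + s *\<^sub>R v + t *\<^sub>R w \<in> U"
  obtains s t where "0 \<le> s" "s \<le> h" "0 \<le> t" "t \<le> h"
    "f (x + h *\<^sub>R v + h *\<^sub>R w) - f (x + h *\<^sub>R v) - f (x + h *\<^sub>R w) + f x =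
      h\<^sup>2 * frechet_derivative (\<lambda>y. frechet_derivative f (at y) v) (at (x + s *\<^sub>R v + t *\<^sub>R w)) w"
proof -
  define D where "D y = frechet_derivative f (at y) v" for y
  define \<phi> where "\<phi> = (\<lambda>s. f (x + h *\<^sub>R w + s *\<^sub>R v) - f (x + s *\<^sub>R v))"
  have D: "Ck_open (Suc 0) U D" using f unfolding D_def by simp
  have d\<phi>: "(\<phi> has_real_derivative D (x + h *\<^sub>R w + s *\<^sub>R v) - D (x + s *\<^sub>R v)) (at s)"
    if s: "0 \<le> s" "s \<le> h" for s
    unfolding \<phi>_def D_def
  proof (intro DERIV_diff has_real_derivative_along_line[OF Ck_open_has_derivative[OF f]])
    show "x + h *\<^sub>R w + s *\<^sub>R v \<in> U" using U[of s h] s \<open>0 < h\<close> by (simp add: algebra_simps)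
    show "x + s *\<^sub>R v \<in> U" using U[of s 0] s \<open>0 < h\<close> by simp
  qed
  obtain s where s: "0 < s" "s < h"
    "\<phi> h - \<phi> 0 = h * (D (x + h *\<^sub>R w + s *\<^sub>R v) - D (x + s *\<^sub>R v))"
    using MVT2[OF \<open>0 < h\<close> d\<phi>] by auto
  have dD: "((\<lambda>t. D (x + s *\<^sub>R v + t *\<^sub>R w)) has_real_derivative
      frechet_derivative D (at (x + s *\<^sub>R v + t *\<^sub>R w)) w) (at t)"
    if "0 \<le> t" "t \<le> h" for t
    by (intro has_real_derivative_along_line[OF Ck_open_has_derivative[OF D]] U) (use s that in auto)
  obtain t where t: "0 < t" "t < h" "D (x + s *\<^sub>R v + h *\<^sub>R w) - D (x + s *\<^sub>R v) =
      h * frechet_derivative D (at (x + s *\<^sub>R v + t *\<^sub>R w)) w"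
    using MVT2[OF \<open>0 < h\<close> dD] by auto
  have eq: "x + h *\<^sub>R w + r *\<^sub>R v = x + r *\<^sub>R v + h *\<^sub>R w" for r by simp
  have "f (x + h *\<^sub>R v + h *\<^sub>R w) - f (x + h *\<^sub>R v) - f (x + h *\<^sub>R w) + f x = \<phi> h - \<phi> 0"
    by (simp add: \<phi>_def eq)
  also have "\<dots> = h\<^sup>2 * frechet_derivative D (at (x + s *\<^sub>R v + t *\<^sub>R w)) w"
    using s(3) t(3) unfolding eq by (simp add: power2_eq_square)
  finally show thesis using that[of s t] s t unfolding D_def by auto
qed

text \<open>The same second difference is expressed through both orders of differentiation, at two
  intermediate points near x. The mixed derivatives therefore agree at these points, and continuity
  at x makes their values at x differ by arbitrarily little.\<close>

lemma symmetric_second_frechet_derivative: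
  fixes f :: "'a::real_normed_vector \<Rightarrow> real"
  assumes "open U" "x \<in> U" and f: "Ck_open (Suc (Suc 0)) U f"
  shows "frechet_derivative (\<lambda>y. frechet_derivative f (at y) v) (at x) w =
    frechet_derivative (\<lambda>y. frechet_derivative f (at y) w) (at x) v"
proof -
  define D where "D v w y = frechet_derivative (\<lambda>y. frechet_derivative f (at y) v) (at y) w" for v w y
  have "continuous_on U (D v w)" for v w
    using f unfolding D_def by simp
  then have cont: "isCont (D v w) x" for v w
    using assms(1,2) continuous_on_eq_continuous_at by blast
  have "\<bar>D v w x - D w v x\<bar> \<le> e" if "0 < e" for e
  proof -
    have "\<forall>\<^sub>F y in nhds x. dist (D v w y) (D v w x) < e / 2 \<and> dist (D w v y) (D w v x) < e / 2 \<and> y \<in> U"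
      using cont[of v w] cont[of w v] \<open>0 < e\<close> eventually_nhds_in_open[OF assms(1,2)]
      unfolding continuous_at tendsto_at_iff_tendsto_nhds
      by (intro eventually_conj) (auto dest!: tendstoD[where e = "e / 2"])
    then obtain d where d: "0 < d" and near: "\<And>y. dist y x < d \<Longrightarrow>
        dist (D v w y) (D v w x) < e / 2 \<and> dist (D w v y) (D w v x) < e / 2 \<and> y \<in> U"
      unfolding eventually_nhds_metric by blast
    \<comment> \<open>Scaled so that the parallelogram spanned by h v and h w at x stays within
      distance d; the summand 1 covers v = w = 0 and makes the bound strict.\<close>
    define h where "h = d / (norm v + norm w + 1)"
    have pos: "0 < norm v + norm w + 1" using norm_ge_zero[of v] norm_ge_zero[of w] by linarith
    have h: "0 < h" unfolding h_def using d pos by simp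
    have ball: "dist (x + s *\<^sub>R v + t *\<^sub>R w) x < d" if "0 \<le> s" "s \<le> h" "0 \<le> t" "t \<le> h" for s t
    proof -
      have "dist (x + s *\<^sub>R v + t *\<^sub>R w) x = norm (s *\<^sub>R v + t *\<^sub>R w)"
        by (simp add: dist_norm algebra_simps)
      also have "\<dots> \<le> s * norm v + t * norm w"
        using norm_triangle_ineq[of "s *\<^sub>R v" "t *\<^sub>R w"] that by simp
      also have "\<dots> \<le> h * norm v + h * norm w"
        using that by (intro add_mono mult_right_mono) auto
      also have "\<dots> < h * (norm v + norm w + 1)"
        using h by (simp add: algebra_simps)
      also have "\<dots> = d" using pos by (simp add: h_def)
      finally show ?thesis .
    qed
    obtain s t where st: "0 \<le> s" "s \<le> h" "0 \<le> t" "t \<le> h"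
      "f (x + h *\<^sub>R v + h *\<^sub>R w) - f (x + h *\<^sub>R v) - f (x + h *\<^sub>R w) + f x =
        h\<^sup>2 * D v w (x + s *\<^sub>R v + t *\<^sub>R w)"
      unfolding D_def by (rule second_difference_mean_value[OF f h]) (use ball near in blast)+
    have ball': "dist (x + s *\<^sub>R w + t *\<^sub>R v) x < d" if "0 \<le> s" "s \<le> h" "0 \<le> t" "t \<le> h" for s t
      using ball[of t s] that by (simp add: add_ac)
    obtain s' t' where st': "0 \<le> s'" "s' \<le> h" "0 \<le> t'" "t' \<le> h"
      "f (x + h *\<^sub>R w + h *\<^sub>R v) - f (x + h *\<^sub>R w) - f (x + h *\<^sub>R v) + f x =
        h\<^sup>2 * D w v (x + s' *\<^sub>R w + t' *\<^sub>R v)"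
      unfolding D_def by (rule second_difference_mean_value[OF f h]) (use ball' near in blast)+
    have "h\<^sup>2 * D v w (x + s *\<^sub>R v + t *\<^sub>R w) = h\<^sup>2 * D w v (x + s' *\<^sub>R w + t' *\<^sub>R v)"
      unfolding st(5)[symmetric] st'(5)[symmetric] by (simp add: add_ac)
    then have "D v w (x + s *\<^sub>R v + t *\<^sub>R w) = D w v (x + s' *\<^sub>R w + t' *\<^sub>R v)"
      using h by simp
    then show ?thesis
      using near[OF ball[OF st(1-4)]] near[OF ball'[OF st'(1-4)]] unfolding dist_real_def by linarith
  qed
  then have "D v w x = D w v x"
    using field_le_epsilon[of "\<bar>D v w x - D w v x\<bar>" 0] by simp
  then show ?thesis by (simp add: D_def)
qed

section \<open>Functions regular up to the boundary\<close>

lemma Ck_onE: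
  assumes "Ck_on k S f" "x \<in> S"
  obtains U g where "open U" "x \<in> U" "Ck_open k U g" "\<And>y. y \<in> S \<Longrightarrow> y \<in> U \<Longrightarrow> g y = f y"
  using bspec[OF assms(1)[unfolded Ck_on_def] assms(2)] by (elim exE conjE) (simp add: that)

lemma Ck_on_open_imp_Ck_open:
  assumes "Ck_on k S f" "open V" "V \<subseteq> S"
  shows "Ck_open k V f"
proof (rule Ck_open_local)
  fix x assume "x \<in> V"
  then obtain U g where U: "open U" "x \<in> U" "Ck_open k U g"
      "\<And>y. y \<in> S \<Longrightarrow> y \<in> U \<Longrightarrow> g y = f y"
    using Ck_onE[OF assms(1), of x thesis] subsetD[OF assms(3), of x] by simp
  have "Ck_open k (U \<inter> V) f"
  proof (rule Ck_open_cong[OF _ _ Ck_open_subset[OF U(3)]])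
    show "g y = f y" if "y \<in> U \<inter> V" for y
      using that U(4)[of y] assms(3) by blast
  qed (use U(1) assms(2) in auto)
  then show "\<exists>U. open U \<and> x \<in> U \<and> Ck_open k U f"
    using U(1,2) assms(2) \<open>x \<in> V\<close> by blast
qed

lemma Ck_open_imp_continuous_on: "Ck_open k U f \<Longrightarrow> continuous_on U f"
  by (induction k) (simp, blast dest: Ck_open_Suc_imp)

lemma Ck_on_imp_continuous_on:
  assumes "Ck_on k S f"
  shows "continuous_on S f"
  unfolding continuous_on_eq_continuous_within continuous_within
proof
  fix x assume "x \<in> S"
  then obtain U g where U: "open U" "x \<in> U" "Ck_open k U g"
      "\<And>y. y \<in> S \<Longrightarrow> y \<in> U \<Longrightarrow> g y = f y"
    using Ck_onE[OF assms(1), of x thesis] by simp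
  have "isCont g x"
    using Ck_open_imp_continuous_on[OF U(3)] U(1,2) continuous_on_eq_continuous_at by blast
  then have "(g \<longlongrightarrow> f x) (at x within S)"
    using U(2,4) \<open>x \<in> S\<close> by (metis isCont_def tendsto_within_subset subset_UNIV)
  moreover have "\<forall>\<^sub>F y in at x within S. g y = f y"
    unfolding eventually_at_topological using U(1,2,4) by blast
  ultimately show "(f \<longlongrightarrow> f x) (at x within S)"
    by (rule Lim_transform_eventually)
qed

lemma eventually_line_in_open:
  fixes a v :: "'a::real_normed_vector" and r :: real
  assumes "open U" "a + r *\<^sub>R v \<in> U"
  shows "\<forall>\<^sub>F s in nhds r. a + s *\<^sub>R v \<in> U"
proof -
  have "((\<lambda>s. a + s *\<^sub>R v) \<longlongrightarrow> a + r *\<^sub>R v) (nhds r)"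
    by (intro tendsto_intros filterlim_ident)
  then show ?thesis
    using topological_tendstoD assms by blast
qed

lemma frechet_derivative_eq_on_open:
  assumes "open U" "x \<in> U" "\<And>y. y \<in> U \<Longrightarrow> f y = g y" "Ck_open (Suc k) U f"
  shows "frechet_derivative f (at x) = frechet_derivative g (at x)"
  using has_derivative_transform_within_open[OF Ck_open_has_derivative[OF assms(4,2)] assms(1-3)]
  by (rule frechet_derivative_at)

text \<open>Transport along a characteristic starts at t = 0, where no two-sided derivative of the
  solution is available; the right limit there is enough to identify the constant.\<close>

lemma constant_on_right:
  fixes c :: "real \<Rightarrow> real"
  assumes "\<And>s. 0 < s \<Longrightarrow> (c has_real_derivative 0) (at s)" "(c \<longlongrightarrow> l) (at_right 0)" "0 < s"
  shows "c s = l"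
proof -
  have "\<exists>k. \<forall>s\<in>{0<..}. c s = k"
    by (rule has_field_derivative_zero_constant) (auto intro: has_field_derivative_at_within assms(1))
  then obtain k where k: "\<And>s. 0 < s \<Longrightarrow> c s = k" by auto
  have "(c \<longlongrightarrow> k) (at_right 0)"
    by (rule tendsto_eventually) (auto simp: eventually_at_right_less k intro: eventually_at_rightI[of 0 1])
  then show ?thesis using tendsto_unique[OF _ _ assms(2)] k[OF assms(3)] by auto
qed

(* The first-order factor (d/dt + d/dx) Psi is constant along the lines x + t = const, where it is
   determined by its limit at t = 0; then Psi itself is integrated along x - t = const. *)
lemma dalembert:
  assumes wave: "circle_wave_solution \<Psi>\<^sub>0 \<Psi>\<^sub>1 \<Psi>"
    and F: "\<And>x. (F has_real_derivative F' x) (at x)"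
    and G: "\<And>x. (G has_real_derivative G' x) (at x)"
    and \<Psi>\<^sub>0: "\<And>x. \<Psi>\<^sub>0 x = F x + G x" and \<Psi>\<^sub>1: "\<And>x. \<Psi>\<^sub>1 x = F' x - G' x"
    and "0 \<le> t"
  shows "\<Psi> x t = F (x + t) + G (x - t)"
proof -
  define f where "f = (\<lambda>(x, t). \<Psi> x t)"
  define S where "S = (UNIV :: real set) \<times> {0::real..}"
  define H where "H = {p :: real \<times> real. 0 < snd p}"
  define D where "D v p = frechet_derivative f (at p) v" for v p
  define E where "E v w p = frechet_derivative (D v) (at p) w" for v w p
  let ?e = "(1::real, 0::real)" and ?d = "(0::real, 1::real)" and ?n = "(1::real, 1::real)"
  have "Ck_on 2 S f" and eqn: "\<And>x t. 0 < t \<Longrightarrow> (deriv ^^ 2) (\<lambda>s. \<Psi> x s) t = (deriv ^^ 2) (\<lambda>y. \<Psi> y t) x"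
    and init: "\<And>x. \<Psi> x 0 = \<Psi>\<^sub>0 x" "\<And>x. time_deriv \<Psi> x 0 = \<Psi>\<^sub>1 x"
    using wave unfolding circle_wave_solution_def f_def S_def by auto
  then have fS: "Ck_on (Suc (Suc 0)) S f" by (simp add: numeral_2_eq_2)
  have H: "open H" unfolding H_def by (intro open_Collect_less continuous_intros)
  have fH: "Ck_open (Suc (Suc 0)) H f"
    by (rule Ck_on_open_imp_Ck_open[OF fS H]) (auto simp: H_def S_def)
  have D1: "(f has_derivative (\<lambda>v. D v p)) (at p)" if "p \<in> H" for p
    using Ck_open_has_derivative[OF fH that] unfolding D_def .
  have CD: "Ck_open (Suc 0) H (D v)" for v
    using fH unfolding D_def Ck_open.simps(2)[of "Suc 0"] by blast
  have D2: "(D v has_derivative (\<lambda>w. E v w p)) (at p)" if "p \<in> H" for p v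
    using Ck_open_has_derivative[OF CD that] unfolding E_def .
  have second: "(deriv ^^ 2) (\<lambda>s. f (a + s *\<^sub>R v)) r = E v v (a + r *\<^sub>R v)" if "a + r *\<^sub>R v \<in> H" for a v r
  proof -
    have "\<forall>\<^sub>F s in nhds r. a + s *\<^sub>R v \<in> H"
      by (rule eventually_line_in_open[OF H that])
    then have "\<forall>\<^sub>F s in nhds r. deriv (\<lambda>s. f (a + s *\<^sub>R v)) s = D v (a + s *\<^sub>R v)"
      by (rule eventually_mono) (rule DERIV_imp_deriv[OF has_real_derivative_along_line[OF D1]])
    then have "deriv (deriv (\<lambda>s. f (a + s *\<^sub>R v))) r = deriv (\<lambda>s. D v (a + s *\<^sub>R v)) r"
      by (rule deriv_cong_ev) simp
    then show ?thesis
      using DERIV_imp_deriv[OF has_real_derivative_along_line[OF D2[OF that]]]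
      by (simp add: numeral_2_eq_2)
  qed
  have wave_E: "E ?d ?d p = E ?e ?e p" if "p \<in> H" for p
  proof -
    obtain x t where p: "p = (x, t)" by force
    show ?thesis
      using eqn[of t x] second[of "(x, 0)" t ?d] second[of "(0, t)" x ?e] that
      by (simp add: p f_def H_def)
  qed
  have symm: "E ?e ?d p = E ?d ?e p" if "p \<in> H" for p
    using symmetric_second_frechet_derivative[OF H that fH, of ?e ?d] unfolding E_def D_def .
  have D_add: "D ?n p = D ?e p + D ?d p" if "p \<in> H" for p
    using linear_add[OF has_derivative_linear[OF D1[OF that]], of ?e ?d] by simp
  have E_add: "E ?n w p = E ?e w p + E ?d w p" if "p \<in> H" for p w
  proof -
    have "((\<lambda>p. D ?e p + D ?d p) has_derivative (\<lambda>w. E ?e w p + E ?d w p)) (at p)"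
      by (intro has_derivative_add D2 that)
    then have "(D ?n has_derivative (\<lambda>w. E ?e w p + E ?d w p)) (at p)"
      by (rule has_derivative_transform_within_open[OF _ H that]) (simp add: D_add)
    from frechet_derivative_at[OF this] show ?thesis unfolding E_def by metis
  qed
  \<comment> \<open>The wave operator factors: (-1, 1) is \<open>?d - ?e\<close>, so the mixed terms
    cancel by symmetry and the pure ones by the equation.\<close>
  have char: "E ?n (-1, 1) p = 0" if "p \<in> H" for p
    using linear_diff[OF has_derivative_linear[OF D2[OF that]], of ?n ?d ?e] wave_E[OF that] symm[OF that]
    by (simp add: E_add[OF that])
  \<comment> \<open>The points (y - s, s) form the characteristic x + t = y. At its foot the
    derivative is \<open>\<Psi>\<^sub>0\<close>' + \<open>\<Psi>\<^sub>1\<close> = (F' + G') + (F' -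
    G') = 2 F'.\<close>
  have D_n: "D ?n (y - s, s) = 2 * F' y" if "0 < s" for y s
  proof -
    have der: "((\<lambda>s. D ?n ((y, 0) + s *\<^sub>R (-1, 1))) has_real_derivative 0) (at s)" if "0 < s" for s
      using has_real_derivative_along_line[OF D2, of "(y, 0)" s "(-1, 1)" ?n] that
      by (simp add: H_def char)
    \<comment> \<open>Nothing is known about \<open>\<Psi>\<close> for t < 0, so derivatives at (y,
      0) are taken of a local C^2 extension \<open>g\<close>.\<close>
    obtain U g where U: "open U" "(y, 0) \<in> U" "Ck_open (Suc (Suc 0)) U g"
      "\<And>p. p \<in> S \<Longrightarrow> p \<in> U \<Longrightarrow> g p = f p"
      using Ck_onE[OF fS, of "(y, 0)" thesis] by (simp add: S_def)
    define L where "L v = frechet_derivative g (at (y, 0)) v" for v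
    have g: "(g has_derivative L) (at (y, 0))"
      using Ck_open_has_derivative[OF U(3,2)] unfolding L_def .
    have near: "\<forall>\<^sub>F s in nhds 0. (y, 0) + s *\<^sub>R v \<in> U" for v
      by (rule eventually_line_in_open[OF U(1)]) (simp add: U(2))
    have "((\<lambda>s. g ((y, 0) + s *\<^sub>R ?e)) has_real_derivative L ?e) (at 0)"
      by (rule has_real_derivative_along_line) (simp add: g)
    moreover have "\<forall>\<^sub>F s in nhds 0. g ((y, 0) + s *\<^sub>R ?e) = F (y + s) + G (y + s)"
      using near[of ?e] by (rule eventually_mono) (simp add: U(4) S_def f_def init \<Psi>\<^sub>0)
    ultimately have "((\<lambda>s. F (y + s) + G (y + s)) has_real_derivative L ?e) (at 0)"
      by (subst (asm) DERIV_cong_ev[OF refl _ refl])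
    moreover have "((\<lambda>s. F (y + s) + G (y + s)) has_real_derivative F' y + G' y) (at 0)"
      using F[of y] G[of y] DERIV_shift[of F "F' y" 0 y] DERIV_shift[of G "G' y" 0 y]
      by (intro DERIV_add) (simp_all add: add.commute)
    ultimately have Le: "L ?e = F' y + G' y" by (rule DERIV_unique)
    \<comment> \<open>In the time direction \<open>g\<close> agrees with \<open>\<Psi>\<close> on
      the half-line s \<ge> 0 only, which is what the one-sided \<open>time_deriv\<close>
      sees.\<close>
    have "((\<lambda>s. g ((y, 0) + s *\<^sub>R ?d)) has_real_derivative L ?d) (at 0 within {0..})"
      by (rule DERIV_subset[OF has_real_derivative_along_line]) (simp_all add: g)
    moreover have "\<forall>\<^sub>F s in at 0 within {0..}. g ((y, 0) + s *\<^sub>R ?d) = \<Psi> y s"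
      using near[of ?d] unfolding eventually_at_filter
      by (rule eventually_mono) (simp add: U(4) S_def f_def)
    ultimately have "((\<lambda>s. \<Psi> y s) has_real_derivative L ?d) (at 0 within {0..})"
      using U(2,4) by (subst (asm) has_field_derivative_cong_eventually[where g = "\<lambda>s. \<Psi> y s"])
        (auto simp: S_def f_def)
    then have "time_deriv \<Psi> y 0 = L ?d"
      unfolding time_deriv_def has_real_derivative_iff_has_vector_derivative
      by (intro vector_derivative_within) (auto simp: at_within_Ici_at_right)
    then have Ld: "L ?d = F' y - G' y" by (simp add: init \<Psi>\<^sub>1)
    have Ln: "L ?n = 2 * F' y"
      using linear_add[OF has_derivative_linear[OF g], of ?e ?d] Le Ld by simp
    have "continuous_on U (\<lambda>p. frechet_derivative g (at p) ?n)"
      by (rule Ck_open_imp_continuous_on[of "Suc 0"]) (use U(3) in simp)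
    then have "isCont (\<lambda>p. frechet_derivative g (at p) ?n) (y, 0)"
      using U(1,2) continuous_on_eq_continuous_at by blast
    moreover have "((\<lambda>s. (y, 0::real) + s *\<^sub>R (-1, 1)) \<longlongrightarrow> (y, 0) + 0 *\<^sub>R (-1, 1)) (at_right (0::real))"
      by (rule tendsto_add[OF tendsto_const tendsto_scaleR[OF tendsto_ident_at tendsto_const]])
    ultimately have "((\<lambda>s. frechet_derivative g (at ((y, 0) + s *\<^sub>R (-1, 1))) ?n) \<longlongrightarrow> 2 * F' y) (at_right 0)"
      unfolding Ln[symmetric] L_def
      by (intro isCont_tendsto_compose[where g = "\<lambda>p. frechet_derivative g (at p) ?n"]) simp_all
    moreover have "\<forall>\<^sub>F s in at_right 0. frechet_derivative g (at ((y, 0) + s *\<^sub>R (-1, 1))) ?n =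
        D ?n ((y, 0) + s *\<^sub>R (-1, 1))"
      using near[of "(-1, 1)"] unfolding eventually_at_filter
    proof (rule eventually_mono, intro impI)
      fix s :: real assume s: "(y, 0) + s *\<^sub>R (- 1, 1) \<in> U" "s \<in> {0<..}"
      show "frechet_derivative g (at ((y, 0) + s *\<^sub>R (-1, 1))) ?n = D ?n ((y, 0) + s *\<^sub>R (-1, 1))"
        unfolding D_def
      proof (rule fun_cong[OF frechet_derivative_eq_on_open[OF open_Int[OF U(1) H]]])
        show "Ck_open (Suc (Suc 0)) (U \<inter> H) g"
          by (rule Ck_open_subset[OF U(3)]) simp
        show "g p = f p" if "p \<in> U \<inter> H" for p
          by (rule U(4)) (use that in \<open>auto simp: H_def S_def mem_Times_iff\<close>)
      qed (use s in \<open>simp add: H_def\<close>)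
    qed
    ultimately have "((\<lambda>s. D ?n ((y, 0) + s *\<^sub>R (-1, 1))) \<longlongrightarrow> 2 * F' y) (at_right 0)"
      by (rule Lim_transform_eventually)
    from constant_on_right[OF der this \<open>0 < s\<close>] show ?thesis by simp
  qed
  show ?thesis
  proof (cases "t = 0")
    case True
    then show ?thesis by (simp add: init \<Psi>\<^sub>0)
  next
    case False
    \<comment> \<open>The point (x - t + s, s) lies on the characteristic with y = x - t + 2 s, so
      \<open>D_n\<close> gives the derivative 2 F'(x - t + 2 s), matched by the chain rule for
      \<open>F\<close>. At s = 0 the difference is \<open>\<Psi>\<^sub>0\<close> - \<open>F\<close>
      at x - t, that is G(x - t).\<close>
    define c where "c = (\<lambda>s. f ((x - t, 0) + s *\<^sub>R ?n) - F (x - t + 2 * s))"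
    have "(c has_real_derivative 0) (at s)" if "0 < s" for s
    proof -
      have "((\<lambda>s. f ((x - t, 0) + s *\<^sub>R ?n)) has_real_derivative 2 * F' (x - t + 2 * s)) (at s)"
        using has_real_derivative_along_line[OF D1, of "(x - t, 0)" s ?n] D_n[OF that, of "x - t + 2 * s"] that
        by (simp add: H_def algebra_simps)
      moreover have "((\<lambda>s. F (x - t + 2 * s)) has_real_derivative F' (x - t + 2 * s) * 2) (at s)"
        by (rule DERIV_chain2[OF F]) (auto intro!: derivative_eq_intros)
      ultimately show ?thesis
        unfolding c_def using DERIV_diff by fastforce
    qed
    moreover have "(c \<longlongrightarrow> c 0) (at_right 0)"
    proof -
      have "continuous_on {0..} (\<lambda>s. f ((x - t, 0) + s *\<^sub>R ?n))"
        by (rule continuous_on_compose2[OF Ck_on_imp_continuous_on[OF fS]])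
          (auto simp: S_def intro!: continuous_intros)
      moreover have "continuous_on {0..} (\<lambda>s. F (x - t + 2 * s))"
        by (rule continuous_on_compose2[of UNIV F])
          (auto intro!: continuous_intros continuous_at_imp_continuous_on DERIV_isCont[OF F])
      ultimately have "continuous_on {0..} c" unfolding c_def by (intro continuous_on_diff)
      then have "(c \<longlongrightarrow> c 0) (at 0 within {0..})" by (simp add: continuous_on_def)
      then show ?thesis by (simp only: at_within_Ici_at_right)
    qed
    ultimately have "c t = c 0" using constant_on_right[of c "c 0" t] False \<open>0 \<le> t\<close> by simp
    then show ?thesis by (simp add: c_def f_def init \<Psi>\<^sub>0 algebra_simps)
  qed
qed

subsection \<open>A smooth bump function\<close>

text \<open>The powers of 1/x make the family stable: derivatives are linear combinations of
  members. The smooth function of interest is \<open>flat 0\<close>, equal to exp(-1/x) for x >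
  0.\<close>

definition flat :: "nat \<Rightarrow> real \<Rightarrow> real" where
  "flat n x = (if 0 < x then exp (- inverse x) * inverse x ^ n else 0)"

lemma flat_tendsto_0: "(flat n \<longlongrightarrow> 0) (at 0)"
proof (rule filterlim_split_at)
  have "\<forall>\<^sub>F x in at_left (0::real). flat n x = 0"
    unfolding eventually_at_filter by (rule always_eventually) (simp add: flat_def)
  then show "(flat n \<longlongrightarrow> 0) (at_left 0)" by (rule tendsto_eventually)
  have "((\<lambda>x. inverse x ^ n / exp (inverse x)) \<longlongrightarrow> 0) (at_right (0::real))"
    by (rule filterlim_compose[OF tendsto_power_div_exp_0 filterlim_inverse_at_top_right])
  moreover have "\<forall>\<^sub>F x in at_right (0::real). inverse x ^ n / exp (inverse x) = flat n x"
    unfolding eventually_at_filter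
    by (rule always_eventually) (simp add: flat_def exp_minus divide_inverse mult.commute)
  ultimately show "(flat n \<longlongrightarrow> 0) (at_right 0)" by (rule Lim_transform_eventually)
qed

lemma flat_has_derivative:
  "(flat n has_real_derivative flat (n + 2) x - n * flat (n + 1) x) (at x)"
proof (cases x "0::real" rule: linorder_cases)
  case less
  have "(flat n has_real_derivative 0) (at x)"
    by (rule has_field_derivative_transform_within_open[OF DERIV_const, where S = "{..<0}"])
      (use less in \<open>auto simp: flat_def\<close>)
  then show ?thesis using less by (simp add: flat_def)
next
  case equal
  \<comment> \<open>Away from h = 0 the difference quotient at the origin is
    \<open>flat (n + 1)\<close> itself.\<close>
  have "((\<lambda>h. (flat n (0 + h) - flat n 0) / h) \<longlongrightarrow> 0) (at 0)"
    by (rule Lim_transform_eventually[OF flat_tendsto_0[of "n + 1"]])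
      (auto simp: eventually_at_filter flat_def divide_inverse intro!: always_eventually)
  then show ?thesis using equal by (simp add: DERIV_def flat_def)
next
  case greater
  have "((\<lambda>x. exp (- inverse x) * inverse x ^ n) has_real_derivative
      flat (n + 2) x - n * flat (n + 1) x) (at x)"
  proof -
    have inv: "(inverse has_real_derivative - (inverse x * inverse x)) (at x)"
      using DERIV_inverse[of x] greater by (simp add: power2_eq_square)
    have "flat (n + 2) x - n * flat (n + 1) x =
        exp (- inverse x) * (- (- (inverse x * inverse x))) * inverse x ^ n
        + real n * (- (inverse x * inverse x) * inverse x ^ (n - Suc 0)) * exp (- inverse x)"
      using greater by (cases n) (simp_all add: flat_def algebra_simps)
    then show ?thesis
      using DERIV_mult[OF DERIV_fun_exp[OF DERIV_minus[OF inv]] DERIV_power[OF inv, of n]]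
      by (simp only:)
  qed
  then show ?thesis
    by (rule has_field_derivative_transform_within_open[where S = "{0<..}"])
      (use greater in \<open>auto simp: flat_def\<close>)
qed

lemma Ck_open_flat: "Ck_open k UNIV (flat n)"
proof (induction k arbitrary: n)
  case 0
  show ?case
    by (auto intro!: continuous_at_imp_continuous_on DERIV_isCont[OF flat_has_derivative])
next
  case (Suc k)
  show ?case
  proof (rule Ck_open_SucI)
    show "(flat n has_derivative (\<lambda>v. (flat (n + 2) x - n * flat (n + 1) x) * v)) (at x)" for x
      using flat_has_derivative[of n x] by (simp only: has_field_derivative_def)
    show "Ck_open k UNIV (\<lambda>x. (flat (n + 2) x - n * flat (n + 1) x) * v)" for v
      by (intro Ck_open_mult Ck_open_diff Suc Ck_open_const) simp_all
  qed simp
qed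

lemma smooth_bump_exists:
  assumes "0 < \<delta>"
  obtains b :: "real \<Rightarrow> real" where
    "\<And>k. Ck_open k UNIV b" "b 0 = 1" "\<And>y. \<delta> \<le> \<bar>y\<bar> \<Longrightarrow> b y = 0"
proof
  \<comment> \<open>The argument is at most 0 once |y| \<ge> \<delta>, and squaring avoids the
    corner of |y|. The factor \<open>exp 1\<close> normalises \<open>flat 0 1\<close> =
    exp(-1).\<close>
  let ?b = "\<lambda>y. exp 1 * flat 0 (1 - y * y * inverse (\<delta> * \<delta>))"
  show "Ck_open k UNIV ?b" for k
    by (intro Ck_open_mult Ck_open_diff Ck_open_const Ck_open_real_compose[OF _ Ck_open_flat]
        Ck_open_linear[OF bounded_linear_ident]) simp_all
  show "?b 0 = 1" by (simp add: flat_def flip: exp_add)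
  show "?b y = 0" if "\<delta> \<le> \<bar>y\<bar>" for y
  proof -
    have "\<delta> * \<delta> \<le> y * y" using mult_mono[OF that that] assms by simp
    then have "1 \<le> y * y * inverse (\<delta> * \<delta>)" using assms by (simp add: field_simps)
    then show ?thesis by (simp add: flat_def)
  qed
qed

subsection \<open>Lifting functions on the circle to a tube\<close>

lemma on_circle_shift_int:
  assumes "on_circle f"
  shows "f (x + 2 * pi * of_int n) = f x"
proof (induction n rule: int_induct[of _ 0])
  case base
  then show ?case by simp
next
  case (step1 i)
  then show ?case using assms[unfolded on_circle_def, rule_format, of "x + 2 * pi * of_int i"]
    by (simp add: algebra_simps)
next
  case (step2 i)
  then show ?case using assms[unfolded on_circle_def, rule_format, of "x + 2 * pi * of_int (i - 1)"]
    by (simp add: algebra_simps)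
qed

text \<open>Comparing angles through \<open>cis\<close> hides the multiple of 2 pi between two
  branches; the shift s serves the arguments x + t and x - t.\<close>

lemma on_circle_cis_cong:
  assumes "on_circle f" "cis a = cis b"
  shows "f (a + s) = f (b + s)"
proof -
  obtain n :: int where "a = b + 2 * pi * of_int n"
    using assms(2) sin_cos_eq_iff[of a b] by (auto simp: complex_eq_iff)
  then show ?thesis using on_circle_shift_int[OF assms(1), of "b + s" n] by (simp add: algebra_simps)
qed

text \<open>Discontinuous across the half-plane behind the axis, and 0 by convention on the axis;
  periodicity and the cut-off respectively make this harmless.\<close>

definition azimuth :: "real ^ 3 \<Rightarrow> real" where
  "azimuth p = Arg (Complex (p $ 1) (p $ 2))"

text \<open>The radial cut-off uses r^2 - 1 instead of r - 1: a polynomial in the coordinates, hence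
  smooth on the axis as well.\<close>

definition cyl_lift :: "(real \<Rightarrow> real \<Rightarrow> real) \<Rightarrow> (real \<Rightarrow> real) \<Rightarrow> (real ^ 3) \<times> real \<Rightarrow> real" where
  "cyl_lift W b q = b ((fst q $ 1)\<^sup>2 + (fst q $ 2)\<^sup>2 - 1) * b (fst q $ 3) * W (azimuth (fst q)) (snd q)"

text \<open>With w = x + i y and z the horizontal part of p, the arctan is the argument of z * cnj
  w, the angle from w to z, as long as Re (z * cnj w) > 0. This is a branch of the angle that is
  smooth around w; it matches \<open>azimuth\<close> modulo 2 pi only, hence the
  \<open>cis\<close>.\<close>

lemma cis_azimuth:
  assumes "0 < x * p $ 1 + y * p $ 2"
  shows "cis (azimuth p) =
    cis (Arg (Complex x y) + arctan ((x * p $ 2 - y * p $ 1) * inverse (x * p $ 1 + y * p $ 2)))"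
proof -
  define w z where "w = Complex x y" and "z = Complex (p $ 1) (p $ 2)"
  have nz: "w \<noteq> 0" "z \<noteq> 0" using assms by (auto simp: w_def z_def complex_eq_iff)
  have "Re (z * cnj w) = x * p $ 1 + y * p $ 2" "Im (z * cnj w) = x * p $ 2 - y * p $ 1"
    by (simp_all add: w_def z_def algebra_simps)
  then have "arctan ((x * p $ 2 - y * p $ 1) * inverse (x * p $ 1 + y * p $ 2)) = Arg (z * cnj w)"
    using arg_conv_arctan[of "z * cnj w"] assms by (simp add: divide_inverse)
  moreover have "cis (Arg w + Arg (z * cnj w)) = sgn w * sgn (z * cnj w)"
    using nz by (simp add: cis_Arg flip: cis_mult)
  moreover have "sgn w * sgn (z * cnj w) = sgn z"
  proof -
    have "sgn w * sgn (z * cnj w) = sgn z * (w * cnj w) / (of_real (norm w) * of_real (norm w))"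
      by (simp add: sgn_eq norm_mult mult_ac)
    also have "w * cnj w = of_real (norm w) * of_real (norm w)"
      by (metis complex_norm_square of_real_mult power2_eq_square)
    finally show ?thesis using nz by simp
  qed
  ultimately show ?thesis
    using nz by (simp add: azimuth_def cis_Arg flip: w_def z_def)
qed

text \<open>The shape of the profile serves the density, with \<open>C\<close> = 0, as well as the
  current, with -F in place of F. \<open>C\<close> is a function of time alone and needs no
  periodicity.\<close>

lemma smooth_cyl_lift:
  assumes F: "\<And>k. Ck_open k UNIV F" "on_circle F" and G: "\<And>k. Ck_open k UNIV G" "on_circle G"
    and C: "\<And>k. Ck_open k UNIV C" and b: "\<And>k. Ck_open k UNIV b" "\<And>y. \<delta> \<le> \<bar>y\<bar> \<Longrightarrow> b y = 0"
    and "\<delta> < 1"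
  shows "\<exists>U. open U \<and> q \<in> U \<and> (\<forall>k. Ck_open k U (cyl_lift (\<lambda>x t. F (x + t) + G (x - t) + C t) b))"
    (is "\<exists>U. open U \<and> q \<in> U \<and> (\<forall>k. Ck_open k U ?K)")
proof (cases "fst q $ 1 = 0 \<and> fst q $ 2 = 0")
  case True
  \<comment> \<open>Here r^2 - 1 < - \<delta>, so the radial cut-off vanishes; the axis is included
    since \<delta> < 1.\<close>
  define U where "U = {q :: (real ^ 3) \<times> real. (fst q $ 1)\<^sup>2 + (fst q $ 2)\<^sup>2 < 1 - \<delta>}"
  have U: "open U" unfolding U_def by (intro open_Collect_less continuous_intros)
  have "?K p = 0" if "p \<in> U" for p
    using that b(2) by (simp add: cyl_lift_def U_def)
  then have "Ck_open k U ?K" for k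
    by (intro Ck_open_cong[OF U _ Ck_open_const[of k U 0]]) simp
  then show ?thesis using U True \<open>\<delta> < 1\<close> by (intro exI[of _ U]) (simp add: U_def)
next
  case False
  define x y where "x = fst q $ 1" and "y = fst q $ 2"
  \<comment> \<open>The half-space around q on which the branch \<theta> of the angle, measured from
    q, is smooth.\<close>
  define U where "U = {q :: (real ^ 3) \<times> real. 0 < x * fst q $ 1 + y * fst q $ 2}"
  define \<theta> where "\<theta> p = Arg (Complex x y) +
    arctan ((x * p $ 2 - y * p $ 1) * inverse (x * p $ 1 + y * p $ 2))" for p :: "real ^ 3"
  have U: "open U" unfolding U_def by (intro open_Collect_less continuous_intros)
  have coord: "Ck_open k U (\<lambda>q. fst q $ i)" for k i
    by (intro Ck_open_linear[OF _ U] bounded_linear_compose[OF bounded_linear_vec_nth bounded_linear_fst])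
  have time: "Ck_open k U snd" for k
    by (intro Ck_open_linear[OF _ U] bounded_linear_snd)
  have angle: "Ck_open k U (\<lambda>q. \<theta> (fst q))" for k
    unfolding \<theta>_def
    by (intro Ck_open_add Ck_open_const Ck_open_arctan Ck_open_mult Ck_open_diff Ck_open_inverse U coord)
      (simp add: U_def)
  have "Ck_open k U (\<lambda>q. b (fst q $ 1 * fst q $ 1 + fst q $ 2 * fst q $ 2 - 1) * b (fst q $ 3)
      * (F (\<theta> (fst q) + snd q) + G (\<theta> (fst q) - snd q) + C (snd q)))" for k
    by (intro Ck_open_add Ck_open_mult Ck_open_diff Ck_open_const U coord time angle
        Ck_open_real_compose[OF U b(1)] Ck_open_real_compose[OF U F(1)]
        Ck_open_real_compose[OF U G(1)] Ck_open_real_compose[OF U C])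
  moreover have "b (fst p $ 1 * fst p $ 1 + fst p $ 2 * fst p $ 2 - 1) * b (fst p $ 3)
      * (F (\<theta> (fst p) + snd p) + G (\<theta> (fst p) - snd p) + C (snd p)) = ?K p" if "p \<in> U" for p
  proof -
    have "cis (azimuth (fst p)) = cis (\<theta> (fst p))"
      unfolding \<theta>_def by (rule cis_azimuth) (use that in \<open>simp add: U_def\<close>)
    then show ?thesis
      using on_circle_cis_cong[OF F(2), of "azimuth (fst p)" "\<theta> (fst p)" "snd p"]
        on_circle_cis_cong[OF G(2), of "azimuth (fst p)" "\<theta> (fst p)" "- snd p"]
      by (simp add: cyl_lift_def power2_eq_square)
  qed
  ultimately have "Ck_open k U ?K" for k by (rule Ck_open_cong[OF U, rotated])
  moreover have "q \<in> U"
    using False by (simp add: U_def x_def y_def sum_power2_gt_zero_iff flip: power2_eq_square)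
  ultimately show ?thesis using U by blast
qed

section \<open>The rotation field and divergences of its multiples\<close>

definition rotor :: "real ^ 3 \<Rightarrow> real ^ 3" where
  "rotor p = vector [- p $ 2, p $ 1, 0]"

lemma rotor_nth [simp]: "rotor p $ 1 = - p $ 2" "rotor p $ 2 = p $ 1" "rotor p $ 3 = 0"
  by (simp_all add: rotor_def)

lemma bounded_linear_rotor: "bounded_linear rotor"
  unfolding linear_conv_bounded_linear[symmetric]
  by (rule linearI) (simp_all add: vec_eq_iff forall_3)

text \<open>The matrix of \<open>rotor\<close> has zero diagonal, so of the product rule only the
  derivative of k along the rotation field survives in the trace.\<close>

lemma divergence_scaleR_rotor:
  assumes "(k has_derivative k') (at p)"
  shows "divergence (\<lambda>q. k q *\<^sub>R rotor q) p = k' (rotor p)"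
proof -
  have "((\<lambda>q. k q *\<^sub>R rotor q) has_derivative (\<lambda>v. k p *\<^sub>R rotor v + k' v *\<^sub>R rotor p)) (at p)"
    by (rule has_derivative_scaleR[OF assms bounded_linear_imp_has_derivative[OF bounded_linear_rotor]])
  then have "divergence (\<lambda>q. k q *\<^sub>R rotor q) p =
      (\<Sum>i\<in>UNIV. (k p *\<^sub>R rotor (axis i 1) + k' (axis i 1) *\<^sub>R rotor p) $ i)"
    unfolding divergence_def by (simp flip: frechet_derivative_at)
  also have "\<dots> = k' (axis 1 1) * - p $ 2 + k' (axis 2 1) * p $ 1"
    by (simp add: sum_3 axis_def)
  also have "\<dots> = k' ((- p $ 2) *\<^sub>R axis 1 1 + (p $ 1) *\<^sub>R axis 2 1)"
    using has_derivative_linear[OF assms] by (simp add: linear_diff linear_scale)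
  also have "(- p $ 2) *\<^sub>R axis 1 1 + (p $ 1) *\<^sub>R axis 2 1 = rotor p"
    by (simp add: vec_eq_iff forall_3 axis_def)
  finally show ?thesis .
qed

(* The divergence of a multiple of the rotation field is the derivative along the rotation, under
   which the cut-off factors of the lift are invariant. *)
lemma divergence_cyl_lift:
  assumes W: "\<And>t. on_circle (\<lambda>x. W x t)" and W': "((\<lambda>x. W x t) has_real_derivative W') (at (azimuth p))"
    and smooth: "open U" "(p, t) \<in> U" "Ck_open (Suc 0) U (cyl_lift W b)"
    and b: "b (-1) = 0"
  shows "divergence (\<lambda>q. cyl_lift W b (q, t) *\<^sub>R rotor q) p =
    b ((p $ 1)\<^sup>2 + (p $ 2)\<^sup>2 - 1) * b (p $ 3) * W'"
proof -
  \<comment> \<open>The orbit of p under rotations about the axis, with velocity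
    \<open>rotor p\<close> at s = 0. Following it replaces differentiating \<open>azimuth\<close>:
    along the orbit the angle grows by s, modulo 2 pi.\<close>
  define rot where "rot s = cos s *\<^sub>R vector [p $ 1, p $ 2, 0] + sin s *\<^sub>R rotor p + vector [0, 0, p $ 3]" for s
  define h where "h = b ((p $ 1)\<^sup>2 + (p $ 2)\<^sup>2 - 1) * b (p $ 3)"
  have rot0: "rot 0 = p" by (simp add: rot_def vec_eq_iff forall_3)
  have nth: "rot s $ 1 = cos s * p $ 1 - sin s * p $ 2" "rot s $ 2 = cos s * p $ 2 + sin s * p $ 1"
    "rot s $ 3 = p $ 3" for s by (simp_all add: rot_def)
  have radius: "(rot s $ 1)\<^sup>2 + (rot s $ 2)\<^sup>2 = (p $ 1)\<^sup>2 + (p $ 2)\<^sup>2" for s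
  proof -
    have "(rot s $ 1)\<^sup>2 + (rot s $ 2)\<^sup>2 = ((sin s)\<^sup>2 + (cos s)\<^sup>2) * ((p $ 1)\<^sup>2 + (p $ 2)\<^sup>2)"
      unfolding nth by algebra
    then show ?thesis by simp
  qed
  have lift_rot: "cyl_lift W b (rot s, t) = h * W (azimuth p + s) t" for s
  proof (cases "p $ 1 = 0 \<and> p $ 2 = 0")
    case True
    \<comment> \<open>On the axis the angle is meaningless, but r^2 - 1 = -1 and
      \<open>b (-1) = 0\<close> make both sides vanish.\<close>
    then show ?thesis using b by (simp add: cyl_lift_def h_def radius)
  next
    case False
    have "Complex (rot s $ 1) (rot s $ 2) = cis s * Complex (p $ 1) (p $ 2)"
      by (simp add: complex_eq_iff nth)
    moreover have "Complex (p $ 1) (p $ 2) \<noteq> 0" using False by (simp add: complex_eq_iff)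
    ultimately have "cis (azimuth (rot s)) = cis (azimuth p + s)"
      unfolding azimuth_def by (simp add: cis_Arg sgn_mult flip: cis_mult)
    from on_circle_cis_cong[OF W this, of 0 t] show ?thesis
      by (simp add: cyl_lift_def h_def radius nth(3))
  qed
  have "((\<lambda>q. cyl_lift W b (q, t)) has_derivative (\<lambda>v. frechet_derivative (cyl_lift W b) (at (p, t)) (v, 0))) (at p)"
    (is "(?k has_derivative ?k') _")
    by (rule has_derivative_compose[of "\<lambda>q. (q, t)", OF _ Ck_open_has_derivative[OF smooth(3,2)]])
      (auto intro!: derivative_eq_intros)
  note k = this
  have "(rot has_vector_derivative rotor p) (at 0)"
    unfolding rot_def by (auto intro!: derivative_eq_intros)
  then have "((\<lambda>s. cyl_lift W b (rot s, t)) has_vector_derivative ?k' (rotor p)) (at 0)"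
    using vector_derivative_diff_chain_within[of rot "rotor p" 0 UNIV ?k ?k'] k rot0
    by (simp add: o_def has_derivative_at_withinI)
  moreover have "((\<lambda>s. h * W (azimuth p + s) t) has_real_derivative h * W') (at 0)"
    using DERIV_shift[of "\<lambda>x. W x t" W' 0 "azimuth p"] W'
    by (intro DERIV_cmult) (simp add: add.commute)
  \<comment> \<open>Both sides are the derivative at s = 0 of the lift along the orbit, once by the
    chain rule and once by \<open>lift_rot\<close>.\<close>
  ultimately have "?k' (rotor p) = h * W'"
    unfolding lift_rot has_real_derivative_iff_has_vector_derivative
    by (rule vector_derivative_unique_at)
  then show ?thesis
    using divergence_scaleR_rotor[OF k] unfolding h_def by simp
qed

lemma space_support_subset_annular_tube:
  assumes "\<And>p. f (p, t) \<noteq> 0 \<Longrightarrow> \<bar>(p $ 1)\<^sup>2 + (p $ 2)\<^sup>2 - 1\<bar> \<le> \<epsilon> / 2 \<and> \<bar>p $ 3\<bar> \<le> \<epsilon> / 2"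
    and "0 < \<epsilon>" "\<epsilon> < 1"
  shows "space_support f t \<subseteq> annular_tube \<epsilon>"
proof -
  \<comment> \<open>The support is a closure while the tube is open, so a closed set is placed in
    between; this is why the cut-off has width \<epsilon> / 2.\<close>
  let ?T = "{p :: real ^ 3. \<bar>(p $ 1)\<^sup>2 + (p $ 2)\<^sup>2 - 1\<bar> \<le> \<epsilon> / 2 \<and> \<bar>p $ 3\<bar> \<le> \<epsilon> / 2}"
  have "closed ?T" by (intro closed_Collect_conj closed_Collect_le continuous_intros)
  then have "space_support f t \<subseteq> ?T"
    unfolding space_support_def using assms(1) by (intro closure_minimal) auto
  moreover have "?T \<subseteq> annular_tube \<epsilon>"
  proof
    fix p assume "p \<in> ?T"
    then have "\<bar>(p $ 1)\<^sup>2 + (p $ 2)\<^sup>2 - 1\<bar> \<le> \<epsilon> / 2" and p3: "\<bar>p $ 3\<bar> \<le> \<epsilon> / 2"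
      by blast+
    then have *: "1 - \<epsilon> / 2 \<le> (p $ 1)\<^sup>2 + (p $ 2)\<^sup>2" "(p $ 1)\<^sup>2 + (p $ 2)\<^sup>2 \<le> 1 + \<epsilon> / 2"
      by linarith+
    have e: "\<epsilon>\<^sup>2 < \<epsilon>" using assms by (simp add: power2_eq_square)
    have "(1 - \<epsilon>)\<^sup>2 < (p $ 1)\<^sup>2 + (p $ 2)\<^sup>2"
      using * e assms(2) unfolding power2_diff by simp
    moreover have "(p $ 1)\<^sup>2 + (p $ 2)\<^sup>2 < (1 + \<epsilon>)\<^sup>2"
      using * assms(2) zero_le_power2[of \<epsilon>]
      unfolding power2_sum one_power2 by linarith
    ultimately show "p \<in> annular_tube \<epsilon>"
      using p3 assms(2,3) real_sqrt_less_mono[of _ "(1 + \<epsilon>)\<^sup>2"] real_less_rsqrt[of "1 - \<epsilon>"]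
      by (auto simp: annular_tube_def)
  qed
  ultimately show ?thesis by blast
qed

subsection \<open>The continuity equation in the tube\<close>

lemma smooth_on_UNIV_imp_Ck_open:
  assumes "smooth_on UNIV f"
  shows "Ck_open k UNIV f"
proof (rule Ck_open_local)
  fix x
  obtain U g where U: "open U" "x \<in> U" "\<And>k. Ck_open k U g" "\<And>y. y \<in> U \<Longrightarrow> g y = f y"
    using bspec[OF assms[unfolded smooth_on_def], of x] by auto
  then show "\<exists>U. open U \<and> x \<in> U \<and> Ck_open k U f"
    using Ck_open_cong[OF U(1) U(4) U(3)] by blast
qed

lemma smooth_on_local:
  assumes "\<And>x. \<exists>U. open U \<and> x \<in> U \<and> (\<forall>k. Ck_open k U f)"
  shows "smooth_on S f"
  unfolding smooth_on_def using assms by blast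

section \<open>Antiderivatives, one-sided time derivatives and values on the circle\<close>

lemma Ck_open_antiderivative:
  fixes f P :: "real \<Rightarrow> real"
  assumes "\<And>x. (P has_real_derivative f x) (at x)" "\<And>k. Ck_open k UNIV f"
  shows "Ck_open k UNIV P"
proof (rule Ck_open_Suc_imp, rule Ck_open_SucI)
  show "(P has_derivative (\<lambda>v. f x * v)) (at x)" for x
    using assms(1)[of x] by (simp only: has_field_derivative_def)
  show "Ck_open k UNIV (\<lambda>x. f x * v)" for v
    by (intro Ck_open_mult assms(2) Ck_open_const) simp
qed simp

lemma antiderivative_real_exists:
  fixes f :: "real \<Rightarrow> real"
  assumes "continuous_on UNIV f"
  obtains P where "\<And>x. (P has_real_derivative f x) (at x)"
  using einterval_antiderivative[of "-\<infinity>" "\<infinity>" f] assms that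
  by (auto simp: continuous_on_eq_continuous_at has_real_derivative_iff_has_vector_derivative)

text \<open>Agreement for s \<ge> 0 determines the derivative within \<open>{0..}\<close>, because
  this half-line accumulates at each of its points.\<close>

lemma time_deriv_eq:
  assumes "\<And>s. 0 \<le> s \<Longrightarrow> \<Psi> x s = f s" "(f has_real_derivative f') (at t)" "0 \<le> t"
  shows "time_deriv \<Psi> x t = f'"
proof -
  have "((\<lambda>s. \<Psi> x s) has_vector_derivative f') (at t within {0..})"
  proof (rule has_vector_derivative_transform)
    show "(f has_vector_derivative f') (at t within {0..})"
      using has_field_derivative_at_within[OF assms(2)]
      by (simp only: has_real_derivative_iff_has_vector_derivative)
    show "\<Psi> x s = f s" if "s \<in> {0..}" for s
      using assms(1) that by simp
  qed (use assms(3) in simp)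
  moreover have "at t within {0..} \<noteq> bot"
  proof (cases "t = 0")
    case False
    then have "at t within {0..} = at t"
      using assms(3) by (intro at_within_interior) simp
    then show ?thesis by simp
  next
    case True
    then show ?thesis unfolding True at_within_Ici_at_right by simp
  qed
  ultimately show ?thesis unfolding time_deriv_def by (intro vector_derivative_within)
qed

text \<open>By periodicity of f the difference P(x + 2 pi) - P(x) has derivative 0; its constant
  value is the integral over one period.\<close>

lemma on_circle_antiderivative:
  fixes f P :: "real \<Rightarrow> real"
  assumes P: "\<And>x. (P has_real_derivative f x) (at x)" and "on_circle f" "integral {-pi..pi} f = 0"
  shows "on_circle P"
proof -
  have "(P has_vector_derivative f x) (at x within S)" for x S
    using has_field_derivative_at_within[OF P]
    by (simp only: has_real_derivative_iff_has_vector_derivative)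
  then have "(f has_integral P pi - P (- pi)) {-pi..pi}"
    by (intro fundamental_theorem_of_calculus) simp_all
  then have "P pi = P (- pi)" using assms(3) integral_unique[of f] by simp
  moreover have "P (x + 2 * pi) - P x = P (- pi + 2 * pi) - P (- pi)" for x
  proof (rule DERIV_isconst_all[of "\<lambda>x. P (x + 2 * pi) - P x"], rule allI)
    fix x
    show "((\<lambda>x. P (x + 2 * pi) - P x) has_real_derivative 0) (at x)"
      using DERIV_diff[OF iffD1[OF DERIV_shift P[of "x + 2 * pi"]] P[of x]] assms(2)
      by (simp add: on_circle_def)
  qed
  ultimately show ?thesis by (simp add: on_circle_def)
qed

lemma cyl_lift_circle:
  assumes "\<And>t. on_circle (\<lambda>x. W x t)" "b 0 = 1"
  shows "cyl_lift W b (vector [cos \<theta>, sin \<theta>, 0], t) = W \<theta> t"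
proof -
  have "cis (azimuth (vector [cos \<theta>, sin \<theta>, 0])) = cis \<theta>"
    using cis_Arg[OF cis_neq_zero, of \<theta>] by (simp add: azimuth_def sgn_eq flip: cis.code)
  from on_circle_cis_cong[OF assms(1) this, of 0 t] show ?thesis
    using assms(2) by (simp add: cyl_lift_def)
qed

theorem lemma3p6:
  fixes \<Psi> :: "real \<Rightarrow> real \<Rightarrow> real" and \<Psi>\<^sub>0 \<Psi>\<^sub>1 :: "real \<Rightarrow> real" and \<epsilon> :: real
  assumes "on_circle \<Psi>\<^sub>0" and "smooth_on UNIV \<Psi>\<^sub>0"
    and "on_circle \<Psi>\<^sub>1" and "smooth_on UNIV \<Psi>\<^sub>1"
    and "circle_wave_solution \<Psi>\<^sub>0 \<Psi>\<^sub>1 \<Psi>"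
    and current_on_circle: "\<And>t. t \<ge> 0 \<Longrightarrow> circle_current \<Psi> pi t = circle_current \<Psi> (- pi) t"
    and "0 < \<epsilon>" and "\<epsilon> < 1"
  shows "\<exists>(\<rho>\<^sub>1 :: (real ^ 3) \<times> real \<Rightarrow> real) (Jbar :: (real ^ 3) \<times> real \<Rightarrow> real ^ 3).
           smooth_on (UNIV \<times> {0..}) \<rho>\<^sub>1 \<and>
           smooth_on (UNIV \<times> {0..}) Jbar \<and>
           (\<forall>t\<ge>0. space_support \<rho>\<^sub>1 t \<subseteq> annular_tube \<epsilon> \<and> space_support Jbar t \<subseteq> annular_tube \<epsilon>) \<and>
           (\<forall>p. \<forall>t>0. deriv (\<lambda>s. \<rho>\<^sub>1 (p, s)) t + divergence (\<lambda>q. Jbar (q, t)) p = 0) \<and>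
           (\<forall>\<theta>\<in>{-pi..<pi}. \<forall>t\<ge>0.
              \<rho>\<^sub>1 (vector [cos \<theta>, sin \<theta>, 0], t) = \<Psi> \<theta> t \<and>
              Jbar (vector [cos \<theta>, sin \<theta>, 0], t) =
                circle_current \<Psi> \<theta> t *\<^sub>R vector [- sin \<theta>, cos \<theta>, 0])"
proof -
  note smooth = smooth_on_UNIV_imp_Ck_open[OF assms(2)] smooth_on_UNIV_imp_Ck_open[OF assms(4)]
  obtain P where P: "\<And>x. (P has_real_derivative \<Psi>\<^sub>1 x) (at x)"
    using antiderivative_real_exists Ck_open_imp_continuous_on[OF smooth(2)] by blast
  have \<Psi>\<^sub>0': "(\<Psi>\<^sub>0 has_real_derivative deriv \<Psi>\<^sub>0 x) (at x)" for x
    using smooth(1)[of "Suc 0"] by (simp add: DERIV_deriv_iff_real_differentiable)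
  \<comment> \<open>The additive constant in \<open>P\<close> is arbitrary: it cancels in F + G and,
    because of \<open>C\<close>, also in the current.\<close>
  define F G where "F = (\<lambda>x. (\<Psi>\<^sub>0 x + P x) * (1 / 2))" and "G = (\<lambda>x. (\<Psi>\<^sub>0 x - P x) * (1 / 2))"
  define F' G' where "F' = (\<lambda>x. (deriv \<Psi>\<^sub>0 x + \<Psi>\<^sub>1 x) * (1 / 2))"
    and "G' = (\<lambda>x. (deriv \<Psi>\<^sub>0 x - \<Psi>\<^sub>1 x) * (1 / 2))"
  have F': "(F has_real_derivative F' x) (at x)" and G': "(G has_real_derivative G' x) (at x)" for x
    unfolding F_def G_def F'_def G'_def
    by (rule DERIV_cmult_right DERIV_add DERIV_diff \<Psi>\<^sub>0' P)+
  have F: "Ck_open k UNIV F" and G: "Ck_open k UNIV G" for k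
    unfolding F_def G_def
    by (intro Ck_open_mult Ck_open_add Ck_open_diff Ck_open_const smooth open_UNIV
        Ck_open_antiderivative[OF P])+
  have \<Psi>: "\<Psi> x t = F (x + t) + G (x - t)" if "0 \<le> t" for x t
    by (rule dalembert[OF assms(5) F' G' _ _ that]) (simp_all add: F_def G_def F'_def G'_def field_simps)
  have trans: "((\<lambda>s. F (x + s)) has_real_derivative F' (x + t)) (at t)"
    "((\<lambda>x. F (x + t)) has_real_derivative F' (x + t)) (at x)"
    "((\<lambda>s. G (x - s)) has_real_derivative - G' (x - t)) (at t)"
    "((\<lambda>x. G (x - t)) has_real_derivative G' (x - t)) (at x)" for x t
  proof -
    have "((\<lambda>s. x + s) has_real_derivative 1) (at t)" "((\<lambda>x. x + t) has_real_derivative 1) (at x)"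
      "((\<lambda>s. x - s) has_real_derivative - 1) (at t)" "((\<lambda>x. x - t) has_real_derivative 1) (at x)"
      by (auto intro!: derivative_eq_intros)
    note this[THEN DERIV_chain2[OF F']] this[THEN DERIV_chain2[OF G']]
    then show "((\<lambda>s. F (x + s)) has_real_derivative F' (x + t)) (at t)"
      "((\<lambda>x. F (x + t)) has_real_derivative F' (x + t)) (at x)"
      "((\<lambda>s. G (x - s)) has_real_derivative - G' (x - t)) (at t)"
      "((\<lambda>x. G (x - t)) has_real_derivative G' (x - t)) (at x)"
      by (simp_all only: mult_1_right mult_minus1_right)
  qed
  have \<Psi>': "time_deriv \<Psi> x t = F' (x + t) - G' (x - t)" if "0 \<le> t" for x t
    using time_deriv_eq[OF \<Psi> DERIV_add[OF trans(1,3)] that] by simp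
  \<comment> \<open>The bracket, later named \<open>C\<close>, is the contribution of the lower
    endpoint -pi; being independent of \<theta>, it does not affect the divergence.\<close>
  have current: "circle_current \<Psi> \<theta> t = - F (\<theta> + t) + G (\<theta> - t) + (F (- pi + t) - G (- pi - t))"
    if "0 \<le> t" "- pi \<le> \<theta>" for \<theta> t
  proof -
    have "((\<lambda>y. - (F (y + t) - G (y - t))) has_real_derivative - (F' (y + t) - G' (y - t)))
        (at y within S)" for y S
      by (rule has_field_derivative_at_within[OF DERIV_minus[OF DERIV_diff[OF trans(2,4)]]])
    then have "((\<lambda>y. - (F' (y + t) - G' (y - t))) has_integral
        - (F (\<theta> + t) - G (\<theta> - t)) - - (F (- pi + t) - G (- pi - t))) {- pi..\<theta>}"
      unfolding has_real_derivative_iff_has_vector_derivative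
      by (intro fundamental_theorem_of_calculus that(2))
    then show ?thesis
      unfolding circle_current_def \<Psi>'[OF that(1)] by (simp add: integral_unique)
  qed
  \<comment> \<open>At t = 0 the current at -pi is an integral over one point, and at pi it is minus
    the mean integral of \<open>\<Psi>\<^sub>1\<close>. Periodicity of \<open>F\<close> and
    \<open>G\<close> then needs no later time.\<close>
  have "integral {-pi..pi} \<Psi>\<^sub>1 = 0"
    using current_on_circle[of 0] assms(5) by (simp add: circle_current_def circle_wave_solution_def)
  then have "on_circle P" using on_circle_antiderivative[OF P assms(3)] by simp
  then have circle: "on_circle F" "on_circle G"
    using assms(1) by (simp_all add: on_circle_def F_def G_def)

  obtain b :: "real \<Rightarrow> real" where b: "\<And>k. Ck_open k UNIV b" "b 0 = 1"
    and b0: "\<And>y. \<epsilon> / 2 \<le> \<bar>y\<bar> \<Longrightarrow> b y = 0"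
    using smooth_bump_exists[of "\<epsilon> / 2"] \<open>0 < \<epsilon>\<close> by auto
  define C where "C = (\<lambda>t. F (- pi + t) - G (- pi - t))"
  \<comment> \<open>The summand 0 gives \<open>W\<close> the shape required by
    \<open>smooth_cyl_lift\<close>.\<close>
  define W V where "W = (\<lambda>x t. F (x + t) + G (x - t) + 0)"
    and "V = (\<lambda>x t. - F (x + t) + G (x - t) + C t)"
  define \<rho>\<^sub>1 where "\<rho>\<^sub>1 = cyl_lift W b"
  define Jbar where "Jbar = (\<lambda>q. cyl_lift V b q *\<^sub>R rotor (fst q))"
  have C: "Ck_open k UNIV C" for k
    unfolding C_def
    by (intro Ck_open_diff Ck_open_real_compose[OF open_UNIV F] Ck_open_real_compose[OF open_UNIV G]
        Ck_open_add Ck_open_const Ck_open_linear[OF bounded_linear_ident] open_UNIV)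
  have shift: "x + 2 * pi + t = (x + t) + 2 * pi" "x + 2 * pi - t = (x - t) + 2 * pi" for x t :: real
    by simp_all
  have WV: "on_circle (\<lambda>x. W x t)" "on_circle (\<lambda>x. V x t)" for t
    using circle unfolding on_circle_def W_def V_def shift by simp_all
  have smooth_W: "\<exists>U. open U \<and> q \<in> U \<and> (\<forall>k. Ck_open k U (cyl_lift W b))" for q
    unfolding W_def
    by (rule smooth_cyl_lift[OF F circle(1) G circle(2) Ck_open_const b(1) b0]) (use \<open>\<epsilon> < 1\<close> in auto)
  have smooth_V: "\<exists>U. open U \<and> q \<in> U \<and> (\<forall>k. Ck_open k U (cyl_lift V b))" for q
    unfolding V_def
    by (rule smooth_cyl_lift[OF Ck_open_uminus[OF open_UNIV F] _ G circle(2) C b(1) b0])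
      (use \<open>\<epsilon> < 1\<close> circle(1) in \<open>auto simp: on_circle_def\<close>)
  \<comment> \<open>\<open>F\<close> and \<open>G\<close> live on the whole line, so the lift is
    smooth around boundary points t = 0 too and serves as its own extension.\<close>
  have "smooth_on (UNIV \<times> {0..}) \<rho>\<^sub>1"
    unfolding \<rho>\<^sub>1_def by (rule smooth_on_local[OF smooth_W])
  moreover have "smooth_on (UNIV \<times> {0..}) Jbar"
  proof (rule smooth_on_local)
    fix q
    obtain U where U: "open U" "q \<in> U" "\<And>k. Ck_open k U (cyl_lift V b)" using smooth_V by blast
    have "Ck_open k U Jbar" for k
      unfolding Jbar_def
      by (intro Ck_open_scaleR U Ck_open_linear
          bounded_linear_compose[OF bounded_linear_rotor bounded_linear_fst])
    then show "\<exists>U. open U \<and> q \<in> U \<and> (\<forall>k. Ck_open k U Jbar)" using U by blast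
  qed
  moreover have "space_support \<rho>\<^sub>1 t \<subseteq> annular_tube \<epsilon> \<and> space_support Jbar t \<subseteq> annular_tube \<epsilon>" for t
  proof (intro conjI; rule space_support_subset_annular_tube[OF _ \<open>0 < \<epsilon>\<close> \<open>\<epsilon> < 1\<close>])
    have *: "\<bar>y\<bar> \<le> \<epsilon> / 2" if "b y \<noteq> 0" for y using b0[of y] that by linarith
    fix p :: "real ^ 3"
    show "\<bar>(p $ 1)\<^sup>2 + (p $ 2)\<^sup>2 - 1\<bar> \<le> \<epsilon> / 2 \<and> \<bar>p $ 3\<bar> \<le> \<epsilon> / 2" if "\<rho>\<^sub>1 (p, t) \<noteq> 0"
      using that by (intro conjI *) (auto simp: \<rho>\<^sub>1_def cyl_lift_def)
    show "\<bar>(p $ 1)\<^sup>2 + (p $ 2)\<^sup>2 - 1\<bar> \<le> \<epsilon> / 2 \<and> \<bar>p $ 3\<bar> \<le> \<epsilon> / 2" if "Jbar (p, t) \<noteq> 0"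
      using that by (intro conjI *) (auto simp: Jbar_def cyl_lift_def)
  qed
  moreover have "deriv (\<lambda>s. \<rho>\<^sub>1 (p, s)) t + divergence (\<lambda>q. Jbar (q, t)) p = 0" for p t
  proof -
    define h where "h = b ((p $ 1)\<^sup>2 + (p $ 2)\<^sup>2 - 1) * b (p $ 3)"
    let ?a = "azimuth p"
    have "((\<lambda>s. h * W ?a s) has_real_derivative h * (F' (?a + t) + - G' (?a - t) + 0)) (at t)"
      unfolding W_def by (intro DERIV_cmult DERIV_add trans DERIV_const)
    then have "deriv (\<lambda>s. \<rho>\<^sub>1 (p, s)) t = h * (F' (?a + t) - G' (?a - t))"
      by (simp add: \<rho>\<^sub>1_def cyl_lift_def h_def DERIV_imp_deriv)
    moreover have "divergence (\<lambda>q. Jbar (q, t)) p = h * (- F' (?a + t) + G' (?a - t) + 0)"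
    proof -
      obtain U where U: "open U" "(p, t) \<in> U" "\<And>k. Ck_open k U (cyl_lift V b)" using smooth_V by blast
      have "((\<lambda>x. V x t) has_real_derivative - F' (?a + t) + G' (?a - t) + 0) (at ?a)"
        unfolding V_def by (intro DERIV_add DERIV_minus trans DERIV_const)
      from divergence_cyl_lift[of V, OF WV(2) this U(1,2,3)] show ?thesis
        using b0 \<open>\<epsilon> < 1\<close> by (simp add: Jbar_def h_def)
    qed
    ultimately show ?thesis by (simp add: algebra_simps)
  qed
  \<comment> \<open>The conditions t \<ge> 0 and \<theta> \<ge> -pi enter only here, through the
    formulas for \<open>\<Psi>\<close> and the current; on the circle \<open>rotor\<close> is the
    unit tangent.\<close>
  moreover have "\<rho>\<^sub>1 (vector [cos \<theta>, sin \<theta>, 0], t) = \<Psi> \<theta> t \<and>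
      Jbar (vector [cos \<theta>, sin \<theta>, 0], t) = circle_current \<Psi> \<theta> t *\<^sub>R vector [- sin \<theta>, cos \<theta>, 0]"
    if "\<theta> \<in> {-pi..<pi}" "0 \<le> t" for \<theta> t
    using that cyl_lift_circle[of W b, OF WV(1) b(2)] cyl_lift_circle[of V b, OF WV(2) b(2)]
    by (simp add: \<rho>\<^sub>1_def Jbar_def W_def V_def C_def \<Psi> current rotor_def)
  ultimately show ?thesis by blast
qed

end
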